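(* Let $A_s=\mathrm{diag}(\lambda_1,\ldots,\lambda_n)=\mathrm{diag}(\mu_1I_{n_1},\ldots,\mu_\kappa I_{n_\kappa})\in\mathbb C^{n\times n}$ with pairwise different $\mu_1,\ldots,\mu_\kappa$, and assume $\dim\mathcal C^{\rm for}(A_s)<\infty$. Set $$\mathcal R:=\bigcup_{j=1}^n\mathcal R_j,\qquad \mathcal R_j:=\{m\in\mathbb Z_+^n;\ \langle m,\lambda\rangle=\lambda_j,\ |m|\ge2\},$$ and let $\mathfrak r$ be the number of elements of $\mathcal R$ (hence $\mathfrak r<\infty$). Let $f(x)=Ax+p(x)$ be any formal vector field in Poincaré–Dulac normal form, where $A=A_s+A_n$ has semisimple part $A_s$ and strictly upper triangular nilpotent part $A_n$, and $p$ contains only terms of degree $\ge2$. Let $d$ be the dimension of the space of all linear vector fields commuting with $A$. Then $$d\le\dim\mathcal C^{\rm for}(f)\le d+\mathfrak r.$$ In particular $\dim\mathcal C^{\rm for}(f)\ge n$.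
   Context: Formal vector fields on $\mathbb C^n$ are elements of $\mathbb C[[x_1,\ldots,x_n]]^n$; a matrix $B$ is identified with the linear vector field $x\mapsto Bx$. The Lie bracket is $[g,h](x)=Dh(x)g(x)-Dg(x)h(x)$, and $\mathcal C^{\rm for}(f)=\{g\in\mathbb C[[x_1,\ldots,x_n]]^n;\ [g,f]=0\}$; dimensions are over $\mathbb C$. For $f(x)=Ax+\cdots$ with Jordan–Chevalley decomposition $A=A_s+A_n$ ($A_s$ semisimple, $A_n$ nilpotent, commuting), $f$ is in Poincaré–Dulac normal form if $[A_s,f]=0$. $\mathbb Z_+$ denotes the nonnegative integers, $\lambda=(\lambda_1,\ldots,\lambda_n)$, $\langle m,\lambda\rangle=\sum m_i\lambda_i$, $|m|=\sum m_i$. $I_k$ is the $k\times k$ identity matrix.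
   Formalization: The number r counts each multi-index m once for every j with m in R_j, i.e. r = |R_1|+...+|R_n|; with the plain union the upper bound fails for f(x)=diag(1,2,2)x, where dim C(f)=7, d=5 and the union has one element. *)

theory Defs
  imports "HOL-Analysis.Analysis"
begin

text \<open>
  The variables are indexed by a finite type \<open>'n\<close>; a multi-index in \<open>\<int>\<^sub>+\<^sup>n\<close> is a vector
  \<open>m :: nat ^ 'n\<close>, and \<open>axis j 1\<close> is the multi-index of the variable \<open>x\<^sub>j\<close>.
\<close>

typedef (overloaded) ('a, 'n) mfps = "UNIV :: (nat ^ ('n::finite) \<Rightarrow> 'a) set"
  morphisms mfps_nth Abs_mfps
  by simp

setup_lifting type_definition_mfps

lemma mfps_eqI: "(\<And>m. mfps_nth f m = mfps_nth g m) \<Longrightarrow> f = g"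
  by (simp add: mfps_nth_inject[symmetric] fun_eq_iff)

lemma mfps_nth_Abs [simp]: "mfps_nth (Abs_mfps c) = c"
  by (simp add: Abs_mfps_inverse)

lemma finite_splittings: "finite {(k, l). k + l = (m :: nat ^ ('n::finite))}"
proof -
  have fin: "finite {k :: nat ^ 'n. \<forall>i. k $ i \<le> m $ i}"
  proof (rule finite_subset)
    show "{k :: nat ^ 'n. \<forall>i. k $ i \<le> m $ i} \<subseteq> vec_lambda ` (PiE UNIV (\<lambda>i. {..m $ i}))"
    proof
      fix k :: "nat ^ 'n" assume "k \<in> {k. \<forall>i. k $ i \<le> m $ i}"
      then have "vec_nth k \<in> PiE UNIV (\<lambda>i. {..m $ i})" by auto
      then show "k \<in> vec_lambda ` (PiE UNIV (\<lambda>i. {..m $ i}))"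
        by (metis imageI vec_nth_inverse)
    qed
    show "finite (vec_lambda ` (PiE (UNIV :: 'n set) (\<lambda>i. {..m $ i})))"
      by (intro finite_imageI finite_PiE) auto
  qed
  show ?thesis
    by (rule finite_subset[OF _ finite_cartesian_product[OF fin fin]]) auto
qed

instantiation mfps :: (comm_ring_1, finite) comm_ring_1
begin

lift_definition zero_mfps :: "('a, 'b) mfps" is "\<lambda>_. 0" .

lift_definition one_mfps :: "('a, 'b) mfps" is "\<lambda>m. if m = 0 then 1 else 0" .

lift_definition plus_mfps :: "('a, 'b) mfps \<Rightarrow> ('a, 'b) mfps \<Rightarrow> ('a, 'b) mfps"
  is "\<lambda>f g m. f m + g m" .

lift_definition uminus_mfps :: "('a, 'b) mfps \<Rightarrow> ('a, 'b) mfps"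
  is "\<lambda>f m. - f m" .

lift_definition minus_mfps :: "('a, 'b) mfps \<Rightarrow> ('a, 'b) mfps \<Rightarrow> ('a, 'b) mfps"
  is "\<lambda>f g m. f m - g m" .

lift_definition times_mfps :: "('a, 'b) mfps \<Rightarrow> ('a, 'b) mfps \<Rightarrow> ('a, 'b) mfps"
  is "\<lambda>f g m. \<Sum>(k, l) | k + l = m. f k * g l" .

instance
proof
  fix a b c :: "('a, 'b) mfps"
  show "a * b * c = a * (b * c)"
  proof (rule mfps_eqI)
    fix m :: "nat ^ 'b"
    define S where "S = (\<lambda>m :: nat ^ 'b. {(k, l). k + l = m})"
    have fin: "finite (S m)" for m
      unfolding S_def by (rule finite_splittings)
    have "mfps_nth (a * b * c) m =
        (\<Sum>p\<in>S m. \<Sum>q\<in>S (fst p). mfps_nth a (fst q) * mfps_nth b (snd q) * mfps_nth c (snd p))"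
      by (simp add: times_mfps.rep_eq S_def sum_distrib_right case_prod_beta)
    also have "\<dots> = (\<Sum>(p, q)\<in>Sigma (S m) (\<lambda>p. S (fst p)).
        mfps_nth a (fst q) * mfps_nth b (snd q) * mfps_nth c (snd p))"
      by (rule sum.Sigma) (auto simp: fin)
    also have "\<dots> = (\<Sum>(p, q)\<in>Sigma (S m) (\<lambda>p. S (snd p)).
        mfps_nth a (fst p) * (mfps_nth b (fst q) * mfps_nth c (snd q)))"
      by (rule sum.reindex_bij_witness
          [where i = "\<lambda>((x, y), (u, v)). ((x + u, v), (x, u))"
             and j = "\<lambda>((x, y), (u, v)). ((u, v + y), (v, y))"])
         (auto simp: S_def add.assoc mult.assoc)
    also have "\<dots> = (\<Sum>p\<in>S m. \<Sum>q\<in>S (snd p).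
        mfps_nth a (fst p) * (mfps_nth b (fst q) * mfps_nth c (snd q)))"
      by (rule sum.Sigma[symmetric]) (auto simp: fin)
    also have "\<dots> = mfps_nth (a * (b * c)) m"
      by (simp add: times_mfps.rep_eq S_def sum_distrib_left case_prod_beta)
    finally show "mfps_nth (a * b * c) m = mfps_nth (a * (b * c)) m" .
  qed
  show "a * b = b * a"
  proof (rule mfps_eqI)
    fix m :: "nat ^ 'b"
    show "mfps_nth (a * b) m = mfps_nth (b * a) m"
      unfolding times_mfps.rep_eq
      by (rule sum.reindex_bij_witness[where i = prod.swap and j = prod.swap])
         (auto simp: add.commute mult.commute)
  qed
  show "1 * a = a"
  proof (rule mfps_eqI)
    fix m :: "nat ^ 'b"
    have "mfps_nth (1 * a) m = (\<Sum>(k, l)\<in>{(0 :: nat ^ 'b, m)}. (if k = 0 then 1 else 0) * mfps_nth a l)"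
      unfolding times_mfps.rep_eq one_mfps.rep_eq
      by (rule sum.mono_neutral_right) (auto simp: finite_splittings split: if_splits)
    then show "mfps_nth (1 * a) m = mfps_nth a m" by simp
  qed
  show "(a + b) * c = a * c + b * c"
    by (rule mfps_eqI)
       (simp add: times_mfps.rep_eq plus_mfps.rep_eq case_prod_beta distrib_right sum.distrib)
  show "a + b + c = a + (b + c)" "a + b = b + a" "0 + a = a" "- a + a = 0" "a - b = a + - b"
    by (transfer; simp add: fun_eq_iff algebra_simps)+
  show "(0 :: ('a, 'b) mfps) \<noteq> 1"
    by transfer (metis zero_neq_one)
qed

end

definition mfps_smult :: "'a::comm_ring_1 \<Rightarrow> ('a, 'n::finite) mfps \<Rightarrow> ('a, 'n) mfps" where
  "mfps_smult c f = Abs_mfps (\<lambda>m. c * mfps_nth f m)"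

definition mfps_var :: "'n::finite \<Rightarrow> ('a::comm_ring_1, 'n) mfps" where
  "mfps_var j = Abs_mfps (\<lambda>m. if m = axis j 1 then 1 else 0)"

definition mfps_deriv :: "'n::finite \<Rightarrow> ('a::comm_ring_1, 'n) mfps \<Rightarrow> ('a, 'n) mfps" where
  "mfps_deriv j f = Abs_mfps (\<lambda>m. of_nat (m $ j + 1) * mfps_nth f (m + axis j 1))"

definition mdeg :: "nat ^ 'n::finite \<Rightarrow> nat" where
  "mdeg m = (\<Sum>i\<in>UNIV. m $ i)"

type_synonym 'n fvf = "(complex, 'n) mfps ^ 'n"

definition fvf_scale :: "complex \<Rightarrow> 'n::finite fvf \<Rightarrow> 'n fvf" where
  "fvf_scale c g = (\<chi> i. mfps_smult c (g $ i))"

global_interpretation fvf: vector_space "fvf_scale :: complex \<Rightarrow> 'n::finite fvf \<Rightarrow> 'n fvf"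
  by unfold_locales
     (auto simp: fvf_scale_def mfps_smult_def vec_eq_iff plus_mfps.rep_eq algebra_simps
       intro!: mfps_eqI)

text \<open>
  The dimension function \<open>fvf.dim\<close> is \<open>0\<close> on infinite-dimensional spaces, so finite
  dimensionality has to be expressed separately.
\<close>

definition fvf_finite_dim :: "'n::finite fvf set \<Rightarrow> bool" where
  "fvf_finite_dim V \<longleftrightarrow> (\<exists>B. finite B \<and> V = fvf.span B)"

definition fvf_jacobian :: "'n::finite fvf \<Rightarrow> (complex, 'n) mfps ^ 'n ^ 'n" where
  "fvf_jacobian g = (\<chi> i j. mfps_deriv j (g $ i))"

definition lie_bracket :: "'n::finite fvf \<Rightarrow> 'n fvf \<Rightarrow> 'n fvf" where
  "lie_bracket g h = fvf_jacobian h *v g - fvf_jacobian g *v h"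

definition formal_centralizer :: "'n::finite fvf \<Rightarrow> 'n fvf set" where
  "formal_centralizer f = {g. lie_bracket g f = 0}"

definition linear_vf :: "complex ^ 'n ^ 'n \<Rightarrow> 'n::finite fvf" where
  "linear_vf B = (\<chi> i. \<Sum>j\<in>UNIV. mfps_smult (B $ i $ j) (mfps_var j))"

definition linear_centralizer :: "complex ^ 'n ^ 'n \<Rightarrow> 'n::finite fvf set" where
  "linear_centralizer A = {g \<in> range linear_vf. lie_bracket g (linear_vf A) = 0}"

definition linear_part :: "'n::finite fvf \<Rightarrow> complex ^ 'n ^ 'n" where
  "linear_part f = (\<chi> i j. mfps_nth (f $ i) (axis j 1))"

definition matrix_of_diag :: "complex ^ 'n \<Rightarrow> complex ^ 'n ^ 'n::finite" where
  "matrix_of_diag v = (\<chi> i j. if i = j then v $ i else 0)"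

text \<open>Over \<open>\<complex>\<close>, semisimple means diagonalizable.\<close>

definition semisimple_mat :: "complex ^ 'n ^ 'n::finite \<Rightarrow> bool" where
  "semisimple_mat S \<longleftrightarrow> (\<exists>(P :: complex ^ 'n ^ 'n) v. invertible P \<and> S = P ** matrix_of_diag v ** matrix_inv P)"

definition nilpotent_mat :: "complex ^ 'n ^ 'n::finite \<Rightarrow> bool" where
  "nilpotent_mat N \<longleftrightarrow> (\<exists>k. (((**) N) ^^ k) (mat 1) = 0)"

definition strictly_upper_triangular ::
    "complex ^ ('n::{finite, linorder}) ^ ('n::{finite, linorder}) \<Rightarrow> bool" where
  "strictly_upper_triangular N \<longleftrightarrow> (\<forall>i j. j \<le> i \<longrightarrow> N $ i $ j = 0)"

definition jordan_chevalley ::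
    "complex ^ 'n ^ 'n::finite \<Rightarrow> complex ^ 'n ^ 'n \<Rightarrow> complex ^ 'n ^ 'n \<Rightarrow> bool" where
  "jordan_chevalley A S N \<longleftrightarrow>
     A = S + N \<and> semisimple_mat S \<and> nilpotent_mat N \<and> S ** N = N ** S"

text \<open>
  The quantifiers range over the unique Jordan--Chevalley decomposition of the linear part.
\<close>

definition poincare_dulac :: "'n::finite fvf \<Rightarrow> bool" where
  "poincare_dulac f \<longleftrightarrow> (\<forall>i. mfps_nth (f $ i) 0 = 0) \<and>
     (\<forall>S N. jordan_chevalley (linear_part f) S N \<longrightarrow> lie_bracket (linear_vf S) f = 0)"

definition resonances :: "complex ^ 'n \<Rightarrow> 'n::finite \<Rightarrow> (nat ^ 'n) set" where
  "resonances lam j =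
     {m. (\<Sum>i\<in>UNIV. of_nat (m $ i) * lam $ i) = lam $ j \<and> mdeg m \<ge> 2}"

text \<open>
  The resonance sets of two equal eigenvalues coincide, so \<open>\<Union>j. resonances lam j\<close> has to be read
  as the union of the indexed family: a multi-index counts once for every \<open>j\<close>.  With the plain
  union of sets the dimension estimate fails: for \<open>f(x) = diag(1, 2, 2) x\<close> the
  centralizer of \<open>f\<close> has dimension 7, with the basis consisting of 5 linear fields and
  \<open>x\<^sub>1\<^sup>2 e\<^sub>2\<close>, \<open>x\<^sub>1\<^sup>2 e\<^sub>3\<close>, while \<open>(2, 0, 0)\<close> is the only resonant multi-index.
\<close>

definition resonance_pairs :: "complex ^ 'n \<Rightarrow> ('n::finite \<times> (nat ^ 'n)) set" where
  "resonance_pairs lam = (SIGMA j:UNIV. resonances lam j)"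

end

theory Submission
  imports Defs
begin

text \<open>
  The monomial field \<open>x\<^sup>m e\<^sub>j\<close> is an eigenvector of \<open>ad A\<^sub>s\<close> with eigenvalue given by the weight
  \<open>\<langle>m, \<lambda>\<rangle> - \<lambda>\<^sub>j\<close>, and weights are additive under the Lie bracket. Choose a positive integer grading
  \<open>\<omega>\<close> for which \<open>f - A\<^sub>s\<close> has only terms of positive grade. Induction along \<open>\<omega>\<close> shows that a field
  commuting with \<open>f\<close> has only terms of \<open>\<lambda>\<close>-weight zero, so \<open>C(f)\<close> is the kernel of \<open>ad f\<close> on the
  finite-dimensional space \<open>C(A\<^sub>s) = V\<^sub>1 \<oplus> V\<^sub>2\<close>, where \<open>V\<^sub>1\<close> consists of linear fields and \<open>V\<^sub>2\<close> is
  spanned by the resonant monomials. Here \<open>ad f\<close> is block triangular with diagonal block \<open>ad A\<close>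
  on \<open>V\<^sub>1\<close>: projecting its kernel to \<open>V\<^sub>1\<close> gives the upper bound, and projecting its image the lower
  one. Finally \<open>ad f\<close> maps the terms of nonnegative \<open>\<omega>\<close>-grade in \<open>C(A\<^sub>s)\<close> to terms of positive
  \<open>\<omega>\<close>-grade, losing at least the \<open>n\<close> dimensions of the fields \<open>x\<^sub>i e\<^sub>i\<close>, hence its kernel has
  dimension at least \<open>n\<close>.
\<close>

section \<open>Rank and nullity on finite-dimensional subspaces\<close>

text \<open>The space of all fields is infinite-dimensional, so rank-nullity is stated relative to a
  subspace inside a finite span. A basis \<open>K\<close> of the kernel is extended to a basis
  \<open>C\<close> of \<open>V\<close>; the images of \<open>C - K\<close> form a basis of the image
  of \<open>V\<close>.\<close>

lemma (in Vector_Spaces.linear) rank_nullity_on: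
  assumes "vs1.subspace V" "V \<subseteq> vs1.span B" "finite B"
  shows "vs1.dim V = vs1.dim {x \<in> V. f x = 0} + vs2.dim (f ` V)"
proof -
  let ?N = "{x \<in> V. f x = 0}"
  obtain K where K: "K \<subseteq> ?N" "vs1.independent K" "?N \<subseteq> vs1.span K" "card K = vs1.dim ?N"
    by (rule vs1.basis_exists)
  obtain C where C: "K \<subseteq> C" "C \<subseteq> V" "vs1.independent C" "V \<subseteq> vs1.span C"
    using vs1.maximal_independent_subset_extend[of K V] K by blast
  have "finite C"
    using vs1.independent_span_bound[OF assms(3) C(3)] C(2) assms(2) by blast
  have span_C: "vs1.span C = V"
    using C assms(1) by (simp add: vs1.span_subspace)
  let ?D = "C - K"
  have D: "vs1.independent ?D"
    using C(3) by (rule vs1.independent_mono) blast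
  \<comment> \<open>A kernel element in the span of \<open>?D\<close> has
    \<open>C\<close>-coordinates supported both in \<open>K\<close> and in \<open>?D\<close>; these
    are disjoint, so all coordinates vanish.\<close>
  have "inj_on f (vs1.span ?D)"
    unfolding inj_on_iff_eq_0[OF vs1.subspace_span]
  proof (intro ballI impI)
    fix x assume x: "x \<in> vs1.span ?D" "f x = 0"
    have "x \<in> V"
      using x(1) vs1.span_mono[of ?D C] span_C by blast
    then have "x \<in> vs1.span K"
      using K(3) x(2) by blast
    then have "vs1.representation C x = vs1.representation K x"
      using vs1.representation_extend[OF C(3) _ C(1)] by simp
    moreover have "vs1.representation C x = vs1.representation ?D x"
      using vs1.representation_extend[OF C(3) x(1)] by simp
    ultimately have "vs1.representation C x b = 0" for b
      using vs1.representation_ne_zero[of K x b] vs1.representation_ne_zero[of ?D x b] by auto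
    then show "x = 0"
      using vs1.sum_nonzero_representation_eq[OF C(3), of x] \<open>x \<in> V\<close> C(4) by auto
  qed
  then have indep: "vs2.independent (f ` ?D)" and inj: "inj_on f ?D"
    using independent_injective_image[OF D] vs1.span_superset inj_on_subset by blast+
  have "f ` V \<subseteq> vs2.span (f ` ?D)"
  proof -
    have "f ` V = vs2.span (f ` C)"
      by (simp add: span_image span_C)
    also have "f ` C \<subseteq> insert 0 (f ` ?D)"
      using K(1) by auto
    finally show ?thesis
      using vs2.span_mono vs2.span_insert_0 by metis
  qed
  moreover have "f ` ?D \<subseteq> f ` V"
    using C(2) by blast
  ultimately have "vs2.dim (f ` V) = card ?D"
    using card_image[OF inj] vs2.basis_card_eq_dim[OF _ _ indep] by simp
  moreover have "vs1.dim V = card C"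
    using vs1.dim_unique[OF C(2,4,3)] by simp
  ultimately show ?thesis
    using K(4) C(1) \<open>finite C\<close> card_mono[OF \<open>finite C\<close> C(1)]
    by (simp add: card_Diff_subset finite_subset)
qed

text \<open>The finite span around \<open>W\<close> matters because \<open>dim\<close> is 0 on
  infinite-dimensional spaces.\<close>

lemma (in vector_space) dim_mono_finite:
  assumes "V \<subseteq> W" "W \<subseteq> span B" "finite B"
  shows "dim V \<le> dim W"
proof -
  obtain C where C: "C \<subseteq> W" "independent C" "W \<subseteq> span C" "card C = dim W"
    by (rule basis_exists)
  moreover have "finite C"
    using independent_span_bound[OF assms(3) C(2)] C(1) assms(2) by blast
  ultimately show ?thesis
    using dim_le_card[of V C] assms(1) by auto
qed

lemma (in vector_space) finite_spanning_subspace: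
  assumes "subspace V" "V \<subseteq> span B" "finite B"
  shows "\<exists>C. finite C \<and> V = span C"
proof -
  obtain C where C: "C \<subseteq> V" "independent C" "V \<subseteq> span C" "card C = dim V"
    by (rule basis_exists)
  moreover have "finite C"
    using independent_span_bound[OF assms(3) C(2)] C(1) assms(2) by blast
  ultimately show ?thesis
    using assms(1) span_subspace by blast
qed

section \<open>Fields with prescribed support\<close>

abbreviation fvf_coeff :: "'n::finite fvf \<Rightarrow> 'n \<Rightarrow> nat ^ 'n \<Rightarrow> complex" where
  "fvf_coeff g j m \<equiv> mfps_nth (g $ j) m"

lemma mfps_nth_simps [simp]:
  "mfps_nth 0 m = 0"
  "mfps_nth (a + b) m = mfps_nth a m + mfps_nth b m"
  "mfps_nth (a - b) m = mfps_nth a m - mfps_nth b m"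
  "mfps_nth (- a) m = - mfps_nth a m"
  "mfps_nth (mfps_smult c a) m = c * mfps_nth a m"
  by (simp_all add: zero_mfps.rep_eq plus_mfps.rep_eq minus_mfps.rep_eq uminus_mfps.rep_eq mfps_smult_def)

lemma fvf_eqI: "(\<And>j m. fvf_coeff g j m = fvf_coeff h j m) \<Longrightarrow> g = h"
  by (simp add: vec_eq_iff mfps_eqI)

lemma mfps_nth_sum: "mfps_nth (\<Sum>i\<in>S. g i) m = (\<Sum>i\<in>S. mfps_nth (g i) m)"
  by (induction S rule: infinite_finite_induct) simp_all

lemma fvf_scale_nth [simp]: "fvf_scale c g $ j = mfps_smult c (g $ j)"
  by (simp add: fvf_scale_def)

lemma fvf_coeff_sum: "fvf_coeff (\<Sum>i\<in>S. g i) j m = (\<Sum>i\<in>S. fvf_coeff (g i) j m)"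
  by (simp add: sum_component mfps_nth_sum)

text \<open>The pair \<open>(j, m)\<close> stands for the field x^m e_j. For infinite
  \<open>S\<close> the members are formal series, not just finite combinations of monomial
  fields.\<close>

definition supported_fields :: "('n::finite \<times> (nat ^ 'n)) set \<Rightarrow> 'n fvf set" where
  "supported_fields S = {g. \<forall>j m. fvf_coeff g j m \<noteq> 0 \<longrightarrow> (j, m) \<in> S}"

definition fvf_restrict :: "('n::finite \<times> (nat ^ 'n)) set \<Rightarrow> 'n fvf \<Rightarrow> 'n fvf" where
  "fvf_restrict S g = (\<chi> j. Abs_mfps (\<lambda>m. if (j, m) \<in> S then fvf_coeff g j m else 0))"

definition monomial_field :: "'n::finite \<times> (nat ^ 'n) \<Rightarrow> 'n fvf" where
  "monomial_field = (\<lambda>(i, k). \<chi> j. Abs_mfps (\<lambda>m. if (j, m) = (i, k) then 1 else 0))"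

lemma fvf_coeff_restrict [simp]:
  "fvf_coeff (fvf_restrict S g) j m = (if (j, m) \<in> S then fvf_coeff g j m else 0)"
  by (simp add: fvf_restrict_def)

lemma fvf_coeff_monomial [simp]:
  "fvf_coeff (monomial_field a) j m = (if (j, m) = a then 1 else 0)"
  by (simp add: monomial_field_def split: prod.split)

lemma linear_fvf_restrict: "Vector_Spaces.linear fvf_scale fvf_scale (fvf_restrict S)"
  by unfold_locales (rule fvf_eqI, simp)+

lemma subspace_supported_fields: "fvf.subspace (supported_fields S)"
  by (auto simp: fvf.subspace_def supported_fields_def) (metis add_0)

lemma inj_monomial_field: "inj monomial_field"
proof (rule injI)
  fix a b :: "'n \<times> (nat ^ 'n)" assume *: "monomial_field a = monomial_field b"
  have "fvf_coeff (monomial_field a) (fst a) (snd a) = 1"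
    by simp
  then show "a = b"
    unfolding * by (simp split: if_splits)
qed

lemma independent_monomial_fields: "fvf.independent (monomial_field ` S)"
  unfolding fvf.independent_explicit_module
proof (intro allI impI)
  fix t u v
  assume t: "finite t" "t \<subseteq> monomial_field ` S" and sum: "(\<Sum>v\<in>t. fvf_scale (u v) v) = 0" and v: "v \<in> t"
  obtain j m where jm: "v = monomial_field (j, m)"
    using t(2) v by auto
  have "0 = fvf_coeff (\<Sum>v\<in>t. fvf_scale (u v) v) j m"
    unfolding sum by simp
  also have "\<dots> = (\<Sum>w\<in>t. if w = v then u v else 0)"
    unfolding fvf_coeff_sum
  proof (rule sum.cong)
    fix w assume "w \<in> t"
    then obtain a where a: "w = monomial_field a"
      using t(2) by auto
    \<comment> \<open>The sum runs over fields, the coefficients over index pairs; injectivity of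
      \<open>monomial_field\<close> translates between the two.\<close>
    have "w = v \<longleftrightarrow> a = (j, m)"
      unfolding a jm by (rule inj_eq[OF inj_monomial_field])
    then show "fvf_coeff (fvf_scale (u w) w) j m = (if w = v then u v else 0)"
      by (auto simp: a)
  qed simp
  finally show "u v = 0"
    using t(1) v by simp
qed

lemma supported_fields_subset_span:
  assumes "finite S"
  shows "supported_fields S \<subseteq> fvf.span (monomial_field ` S)"
proof
  fix g assume g: "g \<in> supported_fields S"
  have "g = (\<Sum>a\<in>S. fvf_scale (fvf_coeff g (fst a) (snd a)) (monomial_field a))"
  proof (rule fvf_eqI)
    fix j m
    have "fvf_coeff (\<Sum>a\<in>S. fvf_scale (fvf_coeff g (fst a) (snd a)) (monomial_field a)) j m =
        (\<Sum>a\<in>S. if (j, m) = a then fvf_coeff g j m else 0)"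
      unfolding fvf_coeff_sum by (rule sum.cong) auto
    also have "\<dots> = fvf_coeff g j m"
      using g assms by (auto simp: supported_fields_def)
    finally show "fvf_coeff g j m =
        fvf_coeff (\<Sum>a\<in>S. fvf_scale (fvf_coeff g (fst a) (snd a)) (monomial_field a)) j m" ..
  qed
  then show "g \<in> fvf.span (monomial_field ` S)"
    by (metis (no_types, lifting) fvf.span_sum fvf.span_scale fvf.span_base imageI)
qed

lemma monomial_field_supported: "a \<in> S \<Longrightarrow> monomial_field a \<in> supported_fields S"
  by (auto simp: supported_fields_def)

lemma dim_supported_fields:
  assumes "finite S"
  shows "fvf.dim (supported_fields S) = card S"
  by (rule fvf.dim_unique[OF _ supported_fields_subset_span[OF assms] independent_monomial_fields])
     (auto simp: monomial_field_supported card_image inj_on_subset[OF inj_monomial_field])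

text \<open>Turns finite dimension of the centralizer of A_s into finiteness of its set of
  monomials: independent vectors in a finite span are finite in number.\<close>

lemma finite_support_if_finite_dim:
  assumes "supported_fields S \<subseteq> fvf.span B" "finite B"
  shows "finite S"
proof -
  have "finite (monomial_field ` S)"
    using fvf.independent_span_bound[OF assms(2) independent_monomial_fields[of S]]
      monomial_field_supported assms(1) by blast
  then show ?thesis
    using finite_imageD inj_on_subset[OF inj_monomial_field] by blast
qed

section \<open>The Lie bracket and weights\<close>

lemma lie_bracket_nth:
  "lie_bracket g h $ j = (\<Sum>i\<in>UNIV. mfps_deriv i (h $ j) * g $ i) - (\<Sum>i\<in>UNIV. mfps_deriv i (g $ j) * h $ i)"
  by (simp add: lie_bracket_def fvf_jacobian_def matrix_vector_mult_def)

lemma mfps_deriv_add: "mfps_deriv i (a + b) = mfps_deriv i a + mfps_deriv i b"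
  by (rule mfps_eqI) (simp add: mfps_deriv_def plus_mfps.rep_eq algebra_simps)

lemma mfps_deriv_smult: "mfps_deriv i (mfps_smult c a) = mfps_smult c (mfps_deriv i a)"
  by (rule mfps_eqI) (simp add: mfps_deriv_def mfps_smult_def algebra_simps)

lemma mfps_mult_smult: "a * mfps_smult c b = mfps_smult c (a * b)"
  by (rule mfps_eqI) (simp add: times_mfps.rep_eq sum_distrib_left case_prod_beta mult.left_commute)

lemma mfps_smult_mult: "mfps_smult c a * b = mfps_smult c (a * b)"
  by (metis mfps_mult_smult mult.commute)

lemma lie_bracket_add:
  "lie_bracket (g + g') h = lie_bracket g h + lie_bracket g' h"
  "lie_bracket g (h + h') = lie_bracket g h + lie_bracket g h'"
  by (simp_all add: vec_eq_iff lie_bracket_nth mfps_deriv_add distrib_left distrib_right sum.distrib)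

lemma lie_bracket_scale: "lie_bracket (fvf_scale c g) h = fvf_scale c (lie_bracket g h)"
  by (rule fvf_eqI)
     (simp add: lie_bracket_nth mfps_nth_sum mfps_deriv_smult mfps_smult_mult mfps_mult_smult
       sum_distrib_left right_diff_distrib)

lemma linear_lie_bracket: "Vector_Spaces.linear fvf_scale fvf_scale (\<lambda>g. lie_bracket g h)"
  by unfold_locales (simp_all add: lie_bracket_add lie_bracket_scale)

lemma lie_bracket_skew: "lie_bracket g h = - lie_bracket h g"
  by (simp add: vec_eq_iff lie_bracket_nth)

text \<open>Some product in the bracket must contribute. Differentiating by x_i lowers one
  multi-index by \<open>axis i 1\<close>; the two cases tell whether \<open>h\<close> or
  \<open>g\<close> is the differentiated factor.\<close>

lemma lie_bracket_support:
  assumes "fvf_coeff (lie_bracket g h) j m \<noteq> 0"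
  obtains a k b l i where "fvf_coeff g a k \<noteq> 0" "fvf_coeff h b l \<noteq> 0"
    "k + l = m + axis i 1" "a = i \<and> b = j \<or> a = j \<and> b = i"
proof -
  have "\<exists>i. mfps_nth (mfps_deriv i (h $ j) * g $ i) m \<noteq> 0 \<or> mfps_nth (mfps_deriv i (g $ j) * h $ i) m \<noteq> 0"
  proof (rule ccontr)
    assume "\<not> ?thesis"
    then have "fvf_coeff (lie_bracket g h) j m = 0"
      by (simp add: lie_bracket_nth mfps_nth_sum)
    with assms show False by simp
  qed
  moreover have "\<exists>k l. k + l = m \<and> mfps_nth a (k + axis i 1) \<noteq> 0 \<and> mfps_nth b l \<noteq> 0"
    if "mfps_nth (mfps_deriv i a * b) m \<noteq> 0" for i and a b :: "(complex, 'a) mfps"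
  proof -
    have "\<exists>(k, l)\<in>{(k, l). k + l = m}. mfps_nth (mfps_deriv i a) k * mfps_nth b l \<noteq> 0"
      using that sum.neutral unfolding times_mfps.rep_eq by (smt (verit) case_prodI2 case_prod_beta)
    then show ?thesis
      by (auto simp: mfps_deriv_def)
  qed
  ultimately obtain i k l where kl: "k + l = m" and
    "fvf_coeff h j (k + axis i 1) \<noteq> 0 \<and> fvf_coeff g i l \<noteq> 0 \<or>
     fvf_coeff g j (k + axis i 1) \<noteq> 0 \<and> fvf_coeff h i l \<noteq> 0"
    by meson
  then show ?thesis
    using that[of i l j "k + axis i 1" i] that[of j "k + axis i 1" i l i] by (auto simp: ac_simps)
qed

text \<open>The coefficient ring is left open: complex eigenvalues give the eigenvalue of ad A_s on
  x^m e_j, while integer weights give gradings for induction.\<close>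

definition monomial_weight :: "'b::comm_ring_1 ^ 'n \<Rightarrow> 'n::finite \<times> (nat ^ 'n) \<Rightarrow> 'b" where
  "monomial_weight w = (\<lambda>(j, m). (\<Sum>i\<in>UNIV. of_nat (m $ i) * w $ i) - w $ j)"

lemma sum_axis_weight:
  "(\<Sum>i\<in>UNIV. of_nat ((axis k 1 :: nat ^ 'n::finite) $ i) * w $ i) = (w $ k :: 'b::comm_ring_1)"
proof -
  have "(\<Sum>i\<in>UNIV. of_nat ((axis k 1 :: nat ^ 'n) $ i) * w $ i) = (\<Sum>i\<in>UNIV. if i = k then w $ i else 0)"
    by (rule sum.cong) (auto simp: axis_def)
  then show ?thesis by simp
qed

text \<open>In both cases \<open>w $ a + w $ b = w $ i + w $ j\<close>, and the surplus
  \<open>w $ i\<close> cancels the weight of \<open>axis i 1\<close>.\<close>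

lemma monomial_weight_add:
  assumes "k + l = m + axis i 1" "a = i \<and> b = j \<or> a = j \<and> b = i"
  shows "monomial_weight w (j, m) = monomial_weight w (a, k) + monomial_weight w (b, l)"
proof -
  have "(\<Sum>i\<in>UNIV. of_nat ((k + l) $ i) * w $ i) = (\<Sum>i'\<in>UNIV. of_nat ((m + axis i 1) $ i') * w $ i')"
    using assms(1) by simp
  then have "(\<Sum>i\<in>UNIV. of_nat (k $ i) * w $ i) + (\<Sum>i\<in>UNIV. of_nat (l $ i) * w $ i) =
      (\<Sum>i\<in>UNIV. of_nat (m $ i) * w $ i) + w $ i"
    by (simp add: distrib_right sum.distrib sum_axis_weight del: One_nat_def)
  then show ?thesis
    using assms(2) by (auto simp: monomial_weight_def algebra_simps)
qed

lemma monomial_weight_axis: "monomial_weight w (j, axis i 1) = w $ i - w $ j"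
  by (simp add: monomial_weight_def sum_axis_weight del: One_nat_def)

section \<open>Coefficients of linear fields\<close>

lemma fvf_coeff_linear_vf:
  "fvf_coeff (linear_vf B) j m = (\<Sum>i\<in>UNIV. if m = axis i 1 then B $ j $ i else 0)"
  by (simp add: linear_vf_def mfps_nth_sum mfps_smult_def mfps_var_def if_distrib cong: if_cong)

lemma fvf_coeff_linear_vf_axis [simp]: "fvf_coeff (linear_vf B) j (axis i 1) = B $ j $ i"
  by (simp add: fvf_coeff_linear_vf axis_eq_axis)

lemma fvf_coeff_linear_vf_nonzero:
  assumes "fvf_coeff (linear_vf B) j m \<noteq> 0"
  obtains i where "m = axis i 1" "B $ j $ i \<noteq> 0"
proof -
  have "\<exists>i. m = axis i 1"
  proof (rule ccontr)
    assume "\<not> ?thesis"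
    then have "fvf_coeff (linear_vf B) j m = 0"
      by (simp add: fvf_coeff_linear_vf del: One_nat_def)
    with assms show False by simp
  qed
  then obtain i where i: "m = axis i 1" by blast
  show thesis
    using assms that[OF i] unfolding i fvf_coeff_linear_vf_axis by simp
qed

lemma linear_vf_add: "linear_vf (B + C) = linear_vf B + linear_vf C"
proof (rule fvf_eqI)
  fix j m
  show "fvf_coeff (linear_vf (B + C)) j m = fvf_coeff (linear_vf B + linear_vf C) j m"
    unfolding vector_add_component mfps_nth_simps fvf_coeff_linear_vf
    by (auto simp flip: sum.distrib intro!: sum.cong)
qed

text \<open>Subtraction of multi-indices truncates at 0, hence the separate case
  \<open>m $ i = 0\<close>.\<close>

lemma mfps_nth_var_mult:
  "mfps_nth (a * mfps_var i) m = (if m $ i = 0 then 0 else mfps_nth a (m - axis i 1))"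
proof -
  let ?P = "{(k, l). k + l = m}"
  have *: "k + l = m \<and> l = axis i 1 \<longleftrightarrow> m $ i \<noteq> 0 \<and> (k, l) = (m - axis i 1, axis i 1)" for k l
  proof
    assume kl: "k + l = m \<and> l = axis i 1"
    then have m: "m = k + axis i 1" by blast
    show "m $ i \<noteq> 0 \<and> (k, l) = (m - axis i 1, axis i 1)"
      using kl unfolding m by (simp add: axis_def)
  next
    assume "m $ i \<noteq> 0 \<and> (k, l) = (m - axis i 1, axis i 1)"
    then show "k + l = m \<and> l = axis i 1"
      by (auto simp: vec_eq_iff axis_def)
  qed
  have "mfps_nth (a * mfps_var i) m =
      (\<Sum>p\<in>?P. if p = (m - axis i 1, axis i 1) then if m $ i = 0 then 0 else mfps_nth a (fst p) else 0)"
    unfolding times_mfps.rep_eq mfps_var_def by (rule sum.cong) (use * in \<open>auto split: if_splits\<close>)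
  also have "\<dots> = (if m $ i = 0 then 0 else mfps_nth a (m - axis i 1))"
    using *[of "m - axis i 1" "axis i 1"] by (simp add: sum.delta finite_splittings)
  finally show ?thesis .
qed

text \<open>Both weights split along the same pair of monomials, so resonance can be combined with
  an integer grading.\<close>

lemma lie_bracket_weights:
  assumes "fvf_coeff (lie_bracket g h) j m \<noteq> 0"
  obtains a k b l where "fvf_coeff g a k \<noteq> 0" "fvf_coeff h b l \<noteq> 0"
    "monomial_weight w (j, m) = monomial_weight w (a, k) + monomial_weight w (b, l)"
    "monomial_weight w' (j, m) = monomial_weight w' (a, k) + monomial_weight w' (b, l)"
  using lie_bracket_support[OF assms] monomial_weight_add by metis

lemma mfps_deriv_var: "mfps_deriv i (mfps_var j) = (if i = j then 1 else 0)"
proof (rule mfps_eqI)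
  fix m :: "nat ^ 'b"
  have *: "m + axis i 1 = axis j 1 \<longleftrightarrow> m = 0 \<and> i = j"
  proof
    assume eq: "m + axis i 1 = axis j 1"
    have k: "m $ k + (if k = i then 1 else 0) = (if k = j then 1 else 0)" for k
      using arg_cong[OF eq, of "\<lambda>m. m $ k"] by (simp add: axis_def split: if_splits)
    show "m = 0 \<and> i = j"
    proof (cases "i = j")
      case True
      then have "m $ l = 0" for l using k[of l] by simp
      with True show ?thesis by (simp add: vec_eq_iff)
    qed (use k[of i] in simp)
  qed auto
  show "mfps_nth (mfps_deriv i (mfps_var j)) m = mfps_nth (if i = j then 1 else (0 :: ('a, 'b) mfps)) m"
    by (simp add: mfps_deriv_def mfps_var_def * one_mfps.rep_eq del: One_nat_def)
qed

text \<open>The operator x_i d/dx_i is diagonal on monomials; derivation along a diagonal linear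
  field is a combination of such operators.\<close>

lemma mfps_nth_deriv_mult_var: "mfps_nth (mfps_deriv i a * mfps_var i) m = of_nat (m $ i) * mfps_nth a m"
proof (cases "m $ i = 0")
  case False
  then have "m - axis i 1 + axis i 1 = m"
    by (simp add: vec_eq_iff axis_def)
  with False show ?thesis
    by (simp add: mfps_nth_var_mult mfps_deriv_def axis_def)
qed (simp add: mfps_nth_var_mult)

lemma linear_vf_diag_nth: "linear_vf (matrix_of_diag v) $ j = mfps_smult (v $ j) (mfps_var j)"
proof -
  have "linear_vf (matrix_of_diag v) $ j = (\<Sum>i\<in>UNIV. if i = j then mfps_smult (v $ j) (mfps_var j) else 0)"
    unfolding linear_vf_def matrix_of_diag_def
    unfolding vec_lambda_beta by (rule sum.cong) (auto intro: mfps_eqI)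
  then show ?thesis by simp
qed

text \<open>The sign is negative because the diagonal field stands in the second slot of the
  bracket.\<close>

lemma lie_bracket_diag:
  "fvf_coeff (lie_bracket g (linear_vf (matrix_of_diag v))) j m = - monomial_weight v (j, m) * fvf_coeff g j m"
proof -
  have "(\<Sum>i\<in>UNIV. mfps_deriv i (linear_vf (matrix_of_diag v) $ j) * g $ i) =
      (\<Sum>i\<in>UNIV. if i = j then mfps_smult (v $ j) (g $ j) else 0)"
    by (rule sum.cong) (auto simp: linear_vf_diag_nth mfps_deriv_smult mfps_deriv_var mfps_smult_mult intro: mfps_eqI)
  then show ?thesis
    by (simp add: lie_bracket_nth mfps_nth_sum linear_vf_diag_nth mfps_mult_smult mfps_nth_deriv_mult_var
        monomial_weight_def sum_distrib_right left_diff_distrib mult.assoc mult.left_commute)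
qed

lemma formal_centralizer_diag:
  "formal_centralizer (linear_vf (matrix_of_diag v)) = supported_fields {a. monomial_weight v a = 0}"
proof -
  have "lie_bracket g (linear_vf (matrix_of_diag v)) = 0 \<longleftrightarrow>
      (\<forall>j m. fvf_coeff g j m \<noteq> 0 \<longrightarrow> monomial_weight v (j, m) = 0)" for g
  proof -
    have "lie_bracket g (linear_vf (matrix_of_diag v)) = 0 \<longleftrightarrow>
      (\<forall>j m. fvf_coeff (lie_bracket g (linear_vf (matrix_of_diag v))) j m = 0)"
      by (metis fvf_eqI mfps_nth_simps(1) zero_index)
    then show ?thesis
      by (auto simp: lie_bracket_diag)
  qed
  then show ?thesis
    by (simp add: formal_centralizer_def supported_fields_def)
qed

text \<open>For a commuting \<open>g\<close>, weight times coefficient of \<open>g\<close> equals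
  the coefficient of \<open>lie_bracket g u\<close>. The latter involves only coefficients of
  \<open>g\<close> with the same \<open>v\<close>-weight and smaller \<open>\<omega>\<close>-grade,
  so those of nonzero \<open>v\<close>-weight vanish by induction.\<close>

lemma formal_centralizer_subset:
  fixes \<omega> :: "int ^ 'n::finite" and u :: "'n fvf"
  assumes \<omega>: "\<And>i. \<omega> $ i \<ge> 0"
    and u: "u \<in> supported_fields {a. monomial_weight v a = 0 \<and> monomial_weight \<omega> a > 0}"
  shows "formal_centralizer (linear_vf (matrix_of_diag v) + u) \<subseteq> supported_fields {a. monomial_weight v a = 0}"
proof
  fix g assume "g \<in> formal_centralizer (linear_vf (matrix_of_diag v) + u)"
  then have "lie_bracket g (linear_vf (matrix_of_diag v)) + lie_bracket g u = 0"
    by (simp add: formal_centralizer_def lie_bracket_add)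
  then have "fvf_coeff (lie_bracket g (linear_vf (matrix_of_diag v)) + lie_bracket g u) j m = 0" for j m
    by simp
  then have coeff: "fvf_coeff (lie_bracket g u) j m = monomial_weight v (j, m) * fvf_coeff g j m" for j m
    by (simp add: lie_bracket_diag)
  \<comment> \<open>A grade can be as low as \<open>- \<omega> $ j\<close>; adding the sum of all
    entries makes it nonnegative, so \<open>nat\<close> preserves strict inequalities.\<close>
  define M where "M a = nat (monomial_weight \<omega> a + sum (($) \<omega>) UNIV)" for a
  have bound: "monomial_weight \<omega> (j, m) + sum (($) \<omega>) UNIV \<ge> 0" for j m
  proof -
    have "\<omega> $ j \<le> sum (($) \<omega>) UNIV"
      by (rule member_le_sum) (auto simp: \<omega>)
    moreover have "(\<Sum>i\<in>UNIV. of_nat (m $ i) * \<omega> $ i) \<ge> 0"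
      by (rule sum_nonneg) (simp add: \<omega>)
    ultimately show ?thesis
      by (simp add: monomial_weight_def)
  qed
  have "monomial_weight v (j, m) \<noteq> 0 \<Longrightarrow> fvf_coeff g j m = 0" for j m
  proof (induction "M (j, m)" arbitrary: j m rule: less_induct)
    case less
    have "fvf_coeff (lie_bracket g u) j m = 0"
    proof (rule ccontr)
      assume "\<not> ?thesis"
      then obtain a k b l where nz: "fvf_coeff g a k \<noteq> 0" "fvf_coeff u b l \<noteq> 0"
        and w: "monomial_weight v (j, m) = monomial_weight v (a, k) + monomial_weight v (b, l)"
          "monomial_weight \<omega> (j, m) = monomial_weight \<omega> (a, k) + monomial_weight \<omega> (b, l)"
        by (rule lie_bracket_weights)
      have b: "monomial_weight v (b, l) = 0" "monomial_weight \<omega> (b, l) > 0"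
        using u nz(2) by (auto simp: supported_fields_def)
      then have "M (a, k) < M (j, m)"
        using w(2) bound[of a k] by (auto simp: M_def)
      then show False
        using less.hyps[of a k] less.prems w(1) b(1) nz(1) by simp
    qed
    then show ?case
      using coeff[of j m] less.prems by simp
  qed
  then show "g \<in> supported_fields {a. monomial_weight v a = 0}"
    by (auto simp: supported_fields_def)
qed

text \<open>Makes the degree rule for brackets an instance of additivity of weights, with linear
  fields in grade 0.\<close>

lemma monomial_weight_one: "monomial_weight (1 :: int ^ 'n) (j, m) = int (mdeg m) - 1" for m :: "nat ^ 'n::finite"
  by (simp add: monomial_weight_def mdeg_def)

lemma mdeg_eq_1_iff: "mdeg m = 1 \<longleftrightarrow> (\<exists>i. m = axis i 1)"
proof
  assume "mdeg m = 1"
  then obtain i where "m $ i = 1" "\<forall>k. i \<noteq> k \<longrightarrow> m $ k = 0"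
    unfolding mdeg_def by (auto simp: sum_eq_Suc0_iff)
  then have "m = axis i 1"
    by (auto simp: vec_eq_iff axis_def)
  then show "\<exists>i. m = axis i 1" ..
qed (auto simp: mdeg_def axis_def)

lemma range_linear_vf: "range linear_vf = supported_fields {a. mdeg (snd a) = 1}"
proof (intro equalityI subsetI)
  fix g :: "'a fvf" assume "g \<in> range linear_vf"
  then show "g \<in> supported_fields {a. mdeg (snd a) = 1}"
    by (auto simp: supported_fields_def mdeg_eq_1_iff simp del: One_nat_def elim: fvf_coeff_linear_vf_nonzero)
next
  fix g :: "'a fvf" assume g: "g \<in> supported_fields {a. mdeg (snd a) = 1}"
  have "g = linear_vf (linear_part g)"
  proof (rule fvf_eqI)
    fix j m
    show "fvf_coeff g j m = fvf_coeff (linear_vf (linear_part g)) j m"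
    proof (cases "mdeg m = 1")
      case True
      then obtain i where "m = axis i 1" unfolding mdeg_eq_1_iff ..
      then show ?thesis
        by (simp only: fvf_coeff_linear_vf_axis) (simp add: linear_part_def)
    next
      case False
      then have "fvf_coeff g j m = 0" "fvf_coeff (linear_vf (linear_part g)) j m = 0"
        using g by (auto simp: supported_fields_def mdeg_eq_1_iff simp del: One_nat_def elim: fvf_coeff_linear_vf_nonzero)
      then show ?thesis by simp
    qed
  qed
  then show "g \<in> range linear_vf" by blast
qed

text \<open>A zero eigenvalue would make every x_j^k e_j a monomial of weight zero.\<close>

lemma eigenvalue_nonzero_if_finite:
  assumes "finite {a. monomial_weight v a = (0 :: complex)}"
  shows "v $ j \<noteq> 0"
proof
  assume "v $ j = 0"
  have "monomial_weight v (j, k *s axis j 1) = 0" for k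
  proof -
    have "(\<Sum>i\<in>UNIV. of_nat ((k *s axis j 1 :: nat ^ 'a) $ i) * v $ i) = 0"
      using \<open>v $ j = 0\<close> by (intro sum.neutral) (auto simp: axis_def)
    then show ?thesis
      using \<open>v $ j = 0\<close> by (simp add: monomial_weight_def)
  qed
  then have "range (\<lambda>k. (j, k *s axis j 1)) \<subseteq> {a. monomial_weight v a = 0}"
    by blast
  moreover have "inj (\<lambda>k :: nat. (j, k *s axis j 1 :: nat ^ 'a))"
    by (rule injI) (auto simp: vec_eq_iff axis_def dest: spec[of _ j])
  ultimately show False
    using assms finite_subset finite_imageD infinite_UNIV_nat by blast
qed

text \<open>Only degree 0 has to be excluded: the constant field e_j has weight
  \<open>- v $ j\<close>, which is nonzero by finiteness.\<close>

lemma zero_weight_split: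
  assumes "finite {a. monomial_weight v a = (0 :: complex)}"
  shows "{a. monomial_weight v a = 0} =
    {a. monomial_weight v a = 0 \<and> mdeg (snd a) = 1} \<union> resonance_pairs v"
proof -
  have "a \<in> resonance_pairs v" if "monomial_weight v a = 0" "mdeg (snd a) \<noteq> 1" for a
  proof (cases a)
    case (Pair j m)
    have "mdeg m \<noteq> 0"
    proof
      assume "mdeg m = 0"
      then have "monomial_weight v (j, m) = - v $ j"
        by (simp add: mdeg_def monomial_weight_def)
      then show False
        using that Pair eigenvalue_nonzero_if_finite[OF assms] by simp
    qed
    with that Pair show ?thesis
      by (simp add: resonance_pairs_def resonances_def monomial_weight_def)
  qed
  moreover have "monomial_weight v a = 0" if "a \<in> resonance_pairs v" for a
    using that by (auto simp: resonance_pairs_def resonances_def monomial_weight_def)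
  ultimately show ?thesis
    by blast
qed

text \<open>In the grading by degree minus one, \<open>g\<close> has grades at least 0, the linear
  field has grade 0 and \<open>p\<close> grades at least 1. Hence grade 0 of the bracket sees only
  the linear parts. Constant terms of \<open>g\<close> would spoil this by meeting quadratic terms
  of \<open>p\<close>.\<close>

lemma restrict_lie_bracket_linear:
  fixes B :: "complex ^ 'n ^ 'n::finite"
  assumes g: "g \<in> supported_fields {a. mdeg (snd a) \<ge> 1}"
    and p: "p \<in> supported_fields {a. mdeg (snd a) \<ge> 2}"
  defines "\<pi> \<equiv> fvf_restrict {a. mdeg (snd a) = 1}"
  shows "\<pi> (lie_bracket g (linear_vf B + p)) = lie_bracket (\<pi> g) (linear_vf B)"
proof (rule fvf_eqI)
  fix j :: 'n and m :: "nat ^ 'n"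
  have lin: "mdeg m = 1" if "fvf_coeff (linear_vf B) j m \<noteq> 0" for j m
    using that range_linear_vf by (auto simp: supported_fields_def set_eq_iff image_iff)
  let ?w = "monomial_weight (1 :: int ^ 'n)"
  \<comment> \<open>Fields starting in degrees \<open>r + 1\<close> and \<open>s + 1\<close> have a
    bracket starting in degree at least \<open>r + s + 1\<close>.\<close>
  have low: "fvf_coeff (lie_bracket h k) j m = 0"
    if "\<And>j m. fvf_coeff h j m \<noteq> 0 \<Longrightarrow> mdeg m \<ge> r + 1" "\<And>j m. fvf_coeff k j m \<noteq> 0 \<Longrightarrow> mdeg m \<ge> s + 1"
      "mdeg m \<le> r + s" for h k :: "'n fvf" and r s
  proof (rule ccontr)
    assume "\<not> ?thesis"
    then obtain a m1 b m2 where "fvf_coeff h a m1 \<noteq> 0" "fvf_coeff k b m2 \<noteq> 0"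
      "?w (j, m) = ?w (a, m1) + ?w (b, m2)"
      by (rule lie_bracket_weights)
    then show False
      using that(1)[of a m1] that(2)[of b m2] that(3) by (simp add: monomial_weight_one)
  qed
  have \<pi>_coeff: "fvf_coeff (\<pi> h) j m = (if mdeg m = 1 then fvf_coeff h j m else 0)" for h j m
    by (simp add: \<pi>_def)
  have "lie_bracket g (linear_vf B + p) =
      lie_bracket (\<pi> g) (linear_vf B) + (lie_bracket (g - \<pi> g) (linear_vf B) + lie_bracket g p)"
    using lie_bracket_add(1)[of "\<pi> g" "g - \<pi> g" "linear_vf B"] by (simp add: lie_bracket_add(2) add.assoc)
  moreover have "fvf_coeff (lie_bracket (g - \<pi> g) (linear_vf B)) j m = 0" if "mdeg m = 1"
  proof (rule low[of _ 1 _ 0])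
    show "mdeg m \<ge> 1 + 1" if "fvf_coeff (g - \<pi> g) j m \<noteq> 0" for j m
    proof -
      have "fvf_coeff g j m \<noteq> 0" "mdeg m \<noteq> 1"
        using that by (auto simp: \<pi>_coeff split: if_splits)
      moreover from this(1) have "mdeg m \<ge> 1"
        using g by (simp add: supported_fields_def)
      ultimately show ?thesis by simp
    qed
  qed (use that lin in auto)
  moreover have "fvf_coeff (lie_bracket g p) j m = 0" if "mdeg m = 1"
    by (rule low[of _ 0 _ 1]) (use that g p in \<open>auto simp: supported_fields_def numeral_2_eq_2\<close>)
  moreover have "fvf_coeff (lie_bracket (\<pi> g) (linear_vf B)) j m = 0" if "mdeg m \<noteq> 1"
  proof (rule ccontr)
    assume "\<not> ?thesis"
    then obtain a k b l where nz: "fvf_coeff (\<pi> g) a k \<noteq> 0" "fvf_coeff (linear_vf B) b l \<noteq> 0"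
      "?w (j, m) = ?w (a, k) + ?w (b, l)"
      by (rule lie_bracket_weights)
    have "mdeg k = 1" "mdeg l = 1"
      using nz(1) lin[OF nz(2)] by (auto simp: \<pi>_coeff split: if_splits)
    then show False
      using nz(3) that by (simp add: monomial_weight_one)
  qed
  ultimately show "fvf_coeff (\<pi> (lie_bracket g (linear_vf B + p))) j m =
      fvf_coeff (lie_bracket (\<pi> g) (linear_vf B)) j m"
    by (simp add: \<pi>_coeff)
qed

section \<open>Dimension estimates\<close>

text \<open>By the intertwining relation \<open>fl\<close>, ad \<open>f\<close> preserves the fields
  supported in \<open>T\<close> and acts on the quotient as ad \<open>fl\<close>. Both bounds apply
  rank-nullity to the projection, whose kernel has dimension at most \<open>card T\<close>.\<close>

lemma lie_bracket_kernel_dim_bounds: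
  fixes f fl :: "'n::finite fvf" and S T :: "('n \<times> (nat ^ 'n)) set"
  assumes fin: "finite S" "finite T" and disj: "S \<inter> T = {}"
    and f: "\<And>g. g \<in> supported_fields (S \<union> T) \<Longrightarrow> lie_bracket g f \<in> supported_fields (S \<union> T)"
    and fl: "\<And>g. g \<in> supported_fields (S \<union> T) \<Longrightarrow>
      fvf_restrict S (lie_bracket g f) = lie_bracket (fvf_restrict S g) fl"
  defines "C \<equiv> {g \<in> supported_fields (S \<union> T). lie_bracket g f = 0}"
    and "Cl \<equiv> {g \<in> supported_fields S. lie_bracket g fl = 0}"
  shows "fvf.dim Cl \<le> fvf.dim C" "fvf.dim C \<le> fvf.dim Cl + card T"
proof -
  let ?V = "supported_fields (S \<union> T)" and ?\<pi> = "fvf_restrict S"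
  let ?L = "\<lambda>g. lie_bracket g f" and ?Ll = "\<lambda>g. lie_bracket g fl"
  let ?B = "monomial_field ` (S \<union> T)"
  interpret L: Vector_Spaces.linear fvf_scale fvf_scale ?L by (rule linear_lie_bracket)
  interpret Ll: Vector_Spaces.linear fvf_scale fvf_scale ?Ll by (rule linear_lie_bracket)
  interpret \<pi>: Vector_Spaces.linear fvf_scale fvf_scale ?\<pi> by (rule linear_fvf_restrict)
  have V_span: "?V \<subseteq> fvf.span ?B" and B: "finite ?B"
    using supported_fields_subset_span[of "S \<union> T"] fin by auto
  have S_V: "supported_fields S \<subseteq> ?V"
    by (auto simp: supported_fields_def)
  have \<pi>_V: "?\<pi> ` ?V = supported_fields S"
  proof
    show "supported_fields S \<subseteq> ?\<pi> ` ?V"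
    proof
      fix g assume g: "g \<in> supported_fields S"
      then have "g = ?\<pi> g"
        by (intro fvf_eqI) (auto simp: supported_fields_def)
      with g S_V show "g \<in> ?\<pi> ` ?V" by blast
    qed
  qed (auto simp: supported_fields_def split: if_splits)
  \<comment> \<open>Needed for two choices of \<open>U\<close>: the kernel \<open>C\<close> and the
    image of \<open>?V\<close> under \<open>?L\<close>.\<close>
  have ker_\<pi>: "fvf.dim {g \<in> U. ?\<pi> g = 0} \<le> card T" if "U \<subseteq> ?V" for U
  proof -
    have "{g \<in> U. ?\<pi> g = 0} \<subseteq> supported_fields T"
    proof
      fix g assume g: "g \<in> {g \<in> U. ?\<pi> g = 0}"
      show "g \<in> supported_fields T"
        unfolding supported_fields_def
      proof (intro CollectI allI impI)
        fix j m assume nz: "fvf_coeff g j m \<noteq> 0"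
        have "fvf_coeff (?\<pi> g) j m = 0"
          using g by simp
        then have "(j, m) \<notin> S"
          using nz by auto
        moreover have "(j, m) \<in> S \<union> T"
          using g that nz by (auto simp: supported_fields_def)
        ultimately show "(j, m) \<in> T" by simp
      qed
    qed
    then have "fvf.dim {g \<in> U. ?\<pi> g = 0} \<le> fvf.dim (supported_fields T)"
      by (rule fvf.dim_mono_finite[OF _ supported_fields_subset_span[OF fin(2)]]) (use fin(2) in simp)
    then show ?thesis
      by (simp only: dim_supported_fields[OF fin(2)])
  qed
  have C: "fvf.subspace C" "C \<subseteq> ?V"
    using subspace_supported_fields[of "S \<union> T"] by (auto simp: C_def fvf.subspace_def L.add L.scale)
  have "fvf.dim C = fvf.dim {g \<in> C. ?\<pi> g = 0} + fvf.dim (?\<pi> ` C)"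
    by (rule \<pi>.rank_nullity_on[OF C(1) _ B]) (use C V_span in blast)
  moreover have "fvf.dim (?\<pi> ` C) \<le> fvf.dim Cl"
  proof (rule fvf.dim_mono_finite[OF _ _ B])
    have "lie_bracket (?\<pi> g) fl = 0" if "g \<in> C" for g
      using that fl[of g] by (simp add: C_def)
    then show "?\<pi> ` C \<subseteq> Cl"
      using C \<pi>_V by (auto simp: Cl_def)
    show "Cl \<subseteq> fvf.span ?B"
      using S_V V_span by (auto simp: Cl_def)
  qed
  ultimately show "fvf.dim C \<le> fvf.dim Cl + card T"
    using ker_\<pi>[OF C(2)] by simp
  have LV: "?L ` ?V \<subseteq> ?V" "fvf.subspace (?L ` ?V)"
    using f L.subspace_image[OF subspace_supported_fields] by auto
  have "?\<pi> ` ?L ` ?V = ?Ll ` ?\<pi> ` ?V"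
    using fl by (force simp: image_image)
  moreover have "fvf.dim (?L ` ?V) = fvf.dim {g \<in> ?L ` ?V. ?\<pi> g = 0} + fvf.dim (?\<pi> ` ?L ` ?V)"
    by (rule \<pi>.rank_nullity_on[OF LV(2) _ B]) (use LV(1) V_span in blast)
  ultimately have "fvf.dim (?L ` ?V) \<le> card T + fvf.dim (?Ll ` supported_fields S)"
    using ker_\<pi>[OF LV(1)] \<pi>_V by simp
  moreover have "fvf.dim ?V = fvf.dim C + fvf.dim (?L ` ?V)"
    unfolding C_def by (rule L.rank_nullity_on[OF subspace_supported_fields V_span B])
  moreover have "fvf.dim (supported_fields S) = fvf.dim Cl + fvf.dim (?Ll ` supported_fields S)"
    unfolding Cl_def by (rule Ll.rank_nullity_on[OF subspace_supported_fields _ B]) (use S_V V_span in blast)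
  \<comment> \<open>Since \<open>?V\<close> has dimension \<open>card S + card T\<close>, the term
    \<open>card T\<close> cancels.\<close>
  ultimately show "fvf.dim Cl \<le> fvf.dim C"
    using fin disj by (simp add: dim_supported_fields card_Un_disjoint)
qed

text \<open>The image has dimension at most \<open>card T\<close>, so rank-nullity leaves the
  difference to the kernel.\<close>

lemma lie_bracket_kernel_dim_ge:
  fixes f :: "'n::finite fvf"
  assumes "finite S" "T \<subseteq> S"
    and f: "\<And>g. g \<in> supported_fields S \<Longrightarrow> lie_bracket g f \<in> supported_fields T"
  shows "card (S - T) \<le> fvf.dim {g \<in> supported_fields S. lie_bracket g f = 0}"
proof -
  have fin: "finite T" using assms finite_subset by blast
  interpret L: Vector_Spaces.linear fvf_scale fvf_scale "\<lambda>g. lie_bracket g f" by (rule linear_lie_bracket)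
  have "fvf.dim (supported_fields S) = fvf.dim {g \<in> supported_fields S. lie_bracket g f = 0} +
      fvf.dim ((\<lambda>g. lie_bracket g f) ` supported_fields S)"
    by (rule L.rank_nullity_on[OF subspace_supported_fields supported_fields_subset_span]) (use assms in auto)
  moreover have "fvf.dim ((\<lambda>g. lie_bracket g f) ` supported_fields S) \<le> fvf.dim (supported_fields T)"
    by (rule fvf.dim_mono_finite[OF _ supported_fields_subset_span]) (use f fin in auto)
  ultimately show ?thesis
    using assms fin by (simp add: dim_supported_fields card_Diff_subset)
qed

text \<open>The offset \<open>n\<close> keeps all weights in \<open>{n..<2n}\<close>, so a monomial of degree at least two
  outweighs every single variable.\<close>

definition triangular_weights :: "int ^ ('n::{finite, linorder})" where
  "triangular_weights = (\<chi> i. int (CARD('n) + card {..<i}))"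

lemma triangular_weights_bounds:
  fixes i :: "'n::{finite, linorder}"
  shows "int CARD('n) \<le> triangular_weights $ i" "triangular_weights $ i < 2 * int CARD('n)"
proof -
  have "card {..<i} < CARD('n)"
    by (rule psubset_card_mono) auto
  then show "int CARD('n) \<le> triangular_weights $ i" "triangular_weights $ i < 2 * int CARD('n)"
    by (simp_all add: triangular_weights_def)
qed

text \<open>Gives the nilpotent part positive grade: an entry in row \<open>j\<close> and column
  \<open>i\<close> belongs to x_i e_j, whose weight is the difference of the two values.\<close>

lemma triangular_weights_less:
  fixes i j :: "'n::{finite, linorder}"
  assumes "j < i"
  shows "triangular_weights $ j < (triangular_weights $ i :: int)"
proof -
  have "card {..<j} < card {..<i}"
    by (rule psubset_card_mono) (use assms in auto)
  then show ?thesis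
    by (simp add: triangular_weights_def)
qed

lemma triangular_weight_degree_ge_2:
  fixes j :: "'n::{finite, linorder}"
  assumes "mdeg m \<ge> 2"
  shows "monomial_weight triangular_weights (j, m) > 0"
proof -
  have "2 * int CARD('n) \<le> int (mdeg m) * int CARD('n)"
    using assms by (intro mult_right_mono) auto
  also have "\<dots> = (\<Sum>i\<in>UNIV. int (m $ i) * int CARD('n))"
    by (simp add: mdeg_def sum_distrib_right)
  also have "\<dots> \<le> (\<Sum>i\<in>UNIV. int (m $ i) * triangular_weights $ i)"
    by (intro sum_mono mult_left_mono triangular_weights_bounds) auto
  finally show ?thesis
    using triangular_weights_bounds(2)[of j] by (simp add: monomial_weight_def)
qed

theorem theorem2:
  fixes lam :: "complex ^ ('n::{finite, linorder})"
    and \<kappa> :: nat and \<mu> :: "nat \<Rightarrow> complex" and ns :: "nat \<Rightarrow> nat"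
    and A As An :: "complex ^ ('n::{finite, linorder}) ^ ('n::{finite, linorder})"
    and f p :: "('n::{finite, linorder}) fvf"
  assumes As_diag: "As = matrix_of_diag lam"
    and blocks: "map (\<lambda>i. lam $ i) (sorted_list_of_set UNIV) =
                   concat (map (\<lambda>k. replicate (ns k) (\<mu> k)) [1..<\<kappa> + 1])"
    and blocks_nonempty: "\<forall>k\<in>{1..\<kappa>}. ns k \<ge> 1"
    and mu_distinct: "inj_on \<mu> {1..\<kappa>}"
    and As_finite: "fvf_finite_dim (formal_centralizer (linear_vf As))"
    and A_decomp: "jordan_chevalley A As An"
    and An_upper: "strictly_upper_triangular An"
    and f_def: "f = linear_vf A + p"
    and p_order: "\<forall>i m. mdeg m < 2 \<longrightarrow> mfps_nth (p $ i) m = 0"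
    and f_normal: "poincare_dulac f"
  shows "finite (resonance_pairs lam) \<and>
         fvf_finite_dim (formal_centralizer f) \<and>
         fvf.dim (linear_centralizer A) \<le> fvf.dim (formal_centralizer f) \<and>
         fvf.dim (formal_centralizer f)
           \<le> fvf.dim (linear_centralizer A) + card (resonance_pairs lam) \<and>
         CARD('n) \<le> fvf.dim (formal_centralizer f)"
proof -

  \<comment> \<open>Monomials commuting with A_s\<close>
  define I where "I = {a. monomial_weight lam a = 0}"
  define S where "S = {a. monomial_weight lam a = 0 \<and> mdeg (snd a) = 1}"
  let ?w = "triangular_weights :: int ^ ('n::{finite, linorder})"
  have centralizer_As: "formal_centralizer (linear_vf As) = supported_fields I"
    by (simp add: As_diag formal_centralizer_diag I_def)
  have fin_I: "finite I"
    using As_finite finite_support_if_finite_dim by (auto simp: fvf_finite_dim_def centralizer_As)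
  have I_split: "I = S \<union> resonance_pairs lam"
    using zero_weight_split fin_I unfolding I_def S_def by blast
  have fin: "finite S" "finite (resonance_pairs lam)"
    using fin_I unfolding I_split by simp_all
  have disj: "S \<inter> resonance_pairs lam = {}"
    by (auto simp: S_def resonance_pairs_def resonances_def)
  have I_deg: "mdeg (snd a) \<ge> 1" if "a \<in> I" for a
    using that unfolding I_split by (auto simp: S_def resonance_pairs_def resonances_def)

  \<comment> \<open>The support of \<open>f\<close> in both gradings\<close>
  have p: "p \<in> supported_fields {a. mdeg (snd a) \<ge> 2}"
    using p_order by (auto simp: supported_fields_def not_less[symmetric])
  have A: "A = As + An"
    using A_decomp by (simp add: jordan_chevalley_def)
  have deg1: "fvf_coeff p j (axis i 1) = 0" for i j
    using p_order mdeg_eq_1_iff[of "axis i 1"] by auto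
  \<comment> \<open>The normal form condition quantifies over decompositions of
    \<open>linear_part f\<close>; identifying it with \<open>A\<close> allows the given
    \<open>As\<close> and \<open>An\<close> to be inserted.\<close>
  have "linear_part f = A"
    by (simp add: linear_part_def f_def deg1 vec_eq_iff del: One_nat_def)
  then have "lie_bracket (linear_vf As) f = 0"
    using f_normal A_decomp unfolding poincare_dulac_def by blast
  then have "f \<in> formal_centralizer (linear_vf As)"
    using lie_bracket_skew[of f "linear_vf As"] by (simp add: formal_centralizer_def)
  then have f_I: "f \<in> supported_fields I"
    by (simp add: centralizer_As)
  have "linear_vf As \<in> formal_centralizer (linear_vf As)"
    by (simp add: formal_centralizer_def lie_bracket_def)
  then have As_I: "linear_vf As \<in> supported_fields I"
    by (simp add: centralizer_As)

  let ?P = "{a. monomial_weight lam a = 0 \<and> monomial_weight ?w a > 0}"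
  have An: "fvf_coeff (linear_vf An) j m \<noteq> 0 \<Longrightarrow> monomial_weight ?w (j, m) > 0" for j m
  proof (erule fvf_coeff_linear_vf_nonzero)
    fix i assume "m = axis i 1" "An $ j $ i \<noteq> 0"
    moreover from this have "j < i"
      using An_upper by (meson strictly_upper_triangular_def leI)
    ultimately show "monomial_weight ?w (j, m) > 0"
      using triangular_weights_less[of j i] by (simp add: monomial_weight_axis del: One_nat_def)
  qed
  have f_split: "f = linear_vf As + (linear_vf An + p)"
    by (simp add: f_def A linear_vf_add)
  have An_p: "linear_vf An + p \<in> supported_fields ?P"
  proof -
    have "monomial_weight ?w (j, m) > 0" if "fvf_coeff (linear_vf An + p) j m \<noteq> 0" for j m
    proof (cases "fvf_coeff p j m = 0")
      case True
      then show ?thesis using that An[of j m] by simp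
    next
      case False
      then show ?thesis using p by (intro triangular_weight_degree_ge_2) (simp add: supported_fields_def)
    qed
    \<comment> \<open>Zero \<open>lam\<close>-weight is inherited from \<open>f\<close> and
      \<open>linear_vf As\<close>, which both commute with A_s.\<close>
    moreover have "linear_vf An + p = f - linear_vf As"
      by (simp add: f_split)
    then have "linear_vf An + p \<in> supported_fields I"
      using f_I As_I fvf.subspace_diff[OF subspace_supported_fields] by metis
    ultimately show ?thesis
      by (auto simp: supported_fields_def I_def)
  qed
  have An_P: "linear_vf An \<in> supported_fields ?P"
  proof -
    \<comment> \<open>In degree one \<open>p\<close> vanishes, so the coefficients of
      \<open>linear_vf An\<close> are those of \<open>linear_vf An + p\<close>.\<close>
    have "monomial_weight lam (j, m) = 0" if nz: "fvf_coeff (linear_vf An) j m \<noteq> 0" for j m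
    proof -
      obtain i where "m = axis i 1"
        using nz by (rule fvf_coeff_linear_vf_nonzero)
      then have "fvf_coeff (linear_vf An + p) j m \<noteq> 0"
        using nz deg1 by simp
      then show ?thesis
        using An_p unfolding supported_fields_def by blast
    qed
    then show ?thesis
      using An by (auto simp: supported_fields_def)
  qed
  have w_nonneg: "?w $ i \<ge> 0" for i
    by (rule order_trans[OF _ triangular_weights_bounds(1)]) simp
  have centralizer_f: "formal_centralizer f \<subseteq> supported_fields I"
    using formal_centralizer_subset[OF w_nonneg An_p] by (simp add: f_split As_diag I_def)
  have centralizer_A: "formal_centralizer (linear_vf A) \<subseteq> supported_fields I"
    using formal_centralizer_subset[OF w_nonneg An_P] by (simp add: A linear_vf_add As_diag I_def)

  \<comment> \<open>The estimates in terms of the linear centralizer\<close>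
  have C_f: "formal_centralizer f = {g \<in> supported_fields (S \<union> resonance_pairs lam). lie_bracket g f = 0}"
    using centralizer_f unfolding I_split by (auto simp: formal_centralizer_def)
  have C_A: "linear_centralizer A = {g \<in> supported_fields S. lie_bracket g (linear_vf A) = 0}"
  proof -
    have "supported_fields S = range linear_vf \<inter> supported_fields I"
      unfolding range_linear_vf S_def I_def by (auto simp: supported_fields_def)
    then show ?thesis
      using centralizer_A by (auto simp: linear_centralizer_def formal_centralizer_def)
  qed
  have I_bracket: "lie_bracket g f \<in> supported_fields I" if g: "g \<in> supported_fields I" for g
  proof -
    have "monomial_weight lam (j, m) = 0" if nz: "fvf_coeff (lie_bracket g f) j m \<noteq> 0" for j m
    proof -
      obtain a k b l where "fvf_coeff g a k \<noteq> 0" "fvf_coeff f b l \<noteq> 0"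
        and w: "monomial_weight lam (j, m) = monomial_weight lam (a, k) + monomial_weight lam (b, l)"
        using nz by (rule lie_bracket_weights)
      then have "(a, k) \<in> I" "(b, l) \<in> I"
        using g f_I by (auto simp: supported_fields_def)
      with w show ?thesis
        by (simp add: I_def)
    qed
    then show ?thesis
      by (auto simp: supported_fields_def I_def)
  qed
  have restr: "fvf_restrict S (lie_bracket g f) = lie_bracket (fvf_restrict S g) (linear_vf A)"
    if g: "g \<in> supported_fields I" for g
  proof -
    \<comment> \<open>On fields of \<open>lam\<close>-weight zero, restricting to \<open>S\<close>
      is the same as taking the linear part.\<close>
    have "fvf_restrict S h = fvf_restrict {a. mdeg (snd a) = 1} h" if "h \<in> supported_fields I" for h
      by (rule fvf_eqI) (use that in \<open>auto simp: supported_fields_def S_def I_def\<close>)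
    moreover have "g \<in> supported_fields {a. mdeg (snd a) \<ge> 1}"
      using g I_deg by (fastforce simp: supported_fields_def)
    ultimately show ?thesis
      using restrict_lie_bracket_linear[OF _ p] g I_bracket[OF g] by (simp add: f_def)
  qed
  note bounds = lie_bracket_kernel_dim_bounds[OF fin disj I_bracket[unfolded I_split] restr[unfolded I_split],
      folded C_f C_A]

  \<comment> \<open>The lower bound by the number of variables\<close>
  let ?I0 = "{a \<in> I. monomial_weight ?w a \<ge> 0}" and ?Ip = "{a \<in> I. monomial_weight ?w a > 0}"
  have "CARD('n) \<le> card (?I0 - ?Ip)"
  proof -
    \<comment> \<open>The fields x_j e_j have weight zero for every choice of weights.\<close>
    have "range (\<lambda>j. (j, axis j 1)) \<subseteq> ?I0 - ?Ip"
      by (auto simp: I_def monomial_weight_axis simp del: One_nat_def)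
    then have "card (range (\<lambda>j :: 'n::{finite, linorder}. (j, axis j (1 :: nat)))) \<le> card (?I0 - ?Ip)"
      by (rule card_mono[rotated]) (use fin_I in simp)
    then show ?thesis
      by (simp add: card_image inj_on_def)
  qed
  also have "\<dots> \<le> fvf.dim {g \<in> supported_fields ?I0. lie_bracket g f = 0}"
  proof (rule lie_bracket_kernel_dim_ge)
    fix g assume g: "g \<in> supported_fields ?I0"
    then have g_I: "g \<in> supported_fields I"
      by (auto simp: supported_fields_def)
    then have "lie_bracket g (linear_vf As) = 0"
      using centralizer_As by (auto simp: formal_centralizer_def)
    \<comment> \<open>The semisimple part drops out, and what remains of \<open>f\<close> has
      positive grade, so the bracket strictly raises the grade.\<close>
    then have f: "lie_bracket g f = lie_bracket g (linear_vf An + p)"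
      by (simp add: f_split lie_bracket_add(2)[of g "linear_vf As"])
    have "monomial_weight ?w (j, m) > 0" if nz: "fvf_coeff (lie_bracket g f) j m \<noteq> 0" for j m
    proof -
      obtain a k b l where "fvf_coeff g a k \<noteq> 0" "fvf_coeff (linear_vf An + p) b l \<noteq> 0"
        and w: "monomial_weight ?w (j, m) = monomial_weight ?w (a, k) + monomial_weight ?w (b, l)"
        using nz unfolding f by (rule lie_bracket_weights)
      then have "(a, k) \<in> ?I0" "(b, l) \<in> ?P"
        using g An_p unfolding supported_fields_def by blast+
      with w show ?thesis
        by simp
    qed
    then show "lie_bracket g f \<in> supported_fields ?Ip"
      using I_bracket[OF g_I] by (auto simp: supported_fields_def)
  qed (use fin_I in auto)
  also have "\<dots> \<le> fvf.dim (formal_centralizer f)"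
  proof (rule fvf.dim_mono_finite)
    show "formal_centralizer f \<subseteq> fvf.span (monomial_field ` I)"
      using centralizer_f supported_fields_subset_span[OF fin_I] by blast
  qed (use fin_I in \<open>auto simp: formal_centralizer_def\<close>)
  finally have "CARD('n) \<le> fvf.dim (formal_centralizer f)" .
  moreover have "fvf_finite_dim (formal_centralizer f)"
    unfolding fvf_finite_dim_def
  proof (rule fvf.finite_spanning_subspace)
    interpret L: Vector_Spaces.linear fvf_scale fvf_scale "\<lambda>g. lie_bracket g f" by (rule linear_lie_bracket)
    show "fvf.subspace (formal_centralizer f)"
      unfolding formal_centralizer_def by (rule L.subspace_kernel)
    show "formal_centralizer f \<subseteq> fvf.span (monomial_field ` I)"
      using centralizer_f supported_fields_subset_span[OF fin_I] by blast
  qed (use fin_I in auto)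
  ultimately show ?thesis
    using bounds fin(2) by blast
qed

end
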